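(* Consider the system $x_{k+1}=A(p_k)x_k+Bu_k$, $y_k=Cx_k$, $k\in\mathbb{N}$. (i) If the system is strictly polytopic (with functions $\xi_i$ and matrices $A_i$, $i\in\mathcal{N}$), then it is poly-Q detectable if and only if there exist matrices $\bar{P}_i\in\mathbb{S}^{n_x}_{\succ 0}$, $i\in\mathcal{N}$, such that $$\bar{P}_i-A_i^\top\bar{P}_jA_i+C^\top C\succ 0\quad\text{for all } i,j\in\mathcal{N}.\qquad( * )$$ (ii) If the system is polytopic (with functions $\xi_i$ and matrices $A_i$, $i\in\mathcal{N}$), then the existence of matrices $\bar{P}_i\in\mathbb{S}^{n_x}_{\succ 0}$, $i\in\mathcal{N}$, satisfying $( * )$ is sufficient for poly-Q detectability. Moreover, if such $\bar{P}_i$ satisfying $( * )$ exist, then the observer gain $$L(k,\bm{p})=-\sum_{i\in\mathcal{N}}\xi_i(p_k)A_i(\bar{P}_i+C^\top C)^{-1}C^\top,\quad k\in\mathbb{N},\ \bm{p}=\{p_k\}_{k\in\mathbb{N}}\in\mathcal{P},$$ renders the error system $e_{k+1}=(A(p_k)+L(k,\bm{p})C)e_k$ poly-QS with poly-QLF $V(\pi,e)=e^\top\big(\sum_{i\in\mathcal{N}}\xi_i(\pi)\bar{P}_i\big)e$.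
   Context: Notation: $\mathbb{N}=\{0,1,2,\dots\}$; $\mathbb{S}^n$ is the set of symmetric $n\times n$ real matrices, $\mathbb{S}^n_{\succ 0}$ the positive definite ones; $M\succ 0$ means $M$ is symmetric positive definite. Setting: $\mathbb{P}\subseteq\mathbb{R}^{n_p}$ is a known compact set, $A\colon\mathbb{P}\to\mathbb{R}^{n_x\times n_x}$, $B\in\mathbb{R}^{n_x\times n_u}$, $C\in\mathbb{R}^{n_y\times n_x}$. $\mathcal{P}$ is the set of all sequences $\bm{p}=\{p_k\}_{k\in\mathbb{N}}$ with $p_k\in\mathbb{P}$ for all $k$. Let $\mathcal{N}=\{1,\dots,N\}$. Polytopic: the system is polytopic if there exist continuous functions $\xi_i\colon\mathbb{P}\to\mathbb{R}_{\geqslant 0}$, $i\in\mathcal{N}$, with $\sum_{i\in\mathcal{N}}\xi_i(\pi)=1$ for all $\pi\in\mathbb{P}$, and matrices $A_i\in\mathbb{R}^{n_x\times n_x}$, $i\in\mathcal{N}$, such that $A(\pi)=\sum_{i\in\mathcal{N}}\xi_i(\pi)A_i$ for all $\pi\in\mathbb{P}$. It is strictly polytopic if, in addition, every unit vector $\bm{e}_i\in\mathbb{R}^N$, $i\in\mathcal{N}$, belongs to $\xi(\mathbb{P})$, where $\xi=(\xi_1,\dots,\xi_N)$. Poly-QS: a system $x_{k+1}=F(k,\bm{p})x_k$ with $F\colon\mathbb{N}\times\mathcal{P}\to\mathbb{R}^{n_x\times n_x}$ is poly-quadratically stable (poly-QS) if it admits a poly-quadratic Lyapunov function (poly-QLF),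 i.e., a function $V(\pi,x)=x^\top P(\pi)x$ with $P(\pi)=\sum_{i\in\mathcal{N}}\xi_i(\pi)\bar{P}_i$, $\bar{P}_i\in\mathbb{S}^{n_x}$ (with the same functions $\xi_i$ as for $A$), such that for some $a_1,a_2,a_3>0$: $a_1\|x\|^2\leqslant V(\pi,x)\leqslant a_2\|x\|^2$ for all $\pi\in\mathbb{P}$, $x\in\mathbb{R}^{n_x}$, and $V(p_{k+1},F(k,\bm{p})x)\leqslant V(p_k,x)-a_3\|x\|^2$ for all $k\in\mathbb{N}$, $\bm{p}\in\mathcal{P}$, $x\in\mathbb{R}^{n_x}$. Observer and poly-Q detectability: observers have the form $\hat{x}_{k+1}=A(p_k)\hat{x}_k+L(k,\bm{p})C(\hat{x}_k-x_k)+Bu_k$ with $L\colon\mathbb{N}\times\mathcal{P}\to\mathbb{R}^{n_x\times n_y}$; the error $e_k=\hat{x}_k-x_k$ satisfies the error system $e_{k+1}=(A(p_k)+L(k,\bm{p})C)e_k$. The system is poly-Q detectable if there exists a function $L\colon\mathbb{N}\times\mathcal{P}\to\mathbb{R}^{n_x\times n_y}$ that renders the error system poly-QS. *)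

theory Defs
  imports "HOL-Analysis.Analysis"
begin

text \<open>Conventions: the dimensions \<open>n\<^sub>p\<close>, \<open>n\<^sub>x\<close>, \<open>n\<^sub>u\<close>, \<open>n\<^sub>y\<close> are the cardinalities of
  the finite types \<open>'p\<close>, \<open>'x\<close>, \<open>'u\<close>, \<open>'y\<close>, and the vertices \<open>1, \<dots>, N\<close> are the elements of
  the finite type \<open>'n\<close>. A matrix in \<open>real ^ 'a ^ 'b\<close> has rows indexed by \<open>'b\<close> and
  columns indexed by \<open>'a\<close>.\<close>

definition sym_mat :: "real ^ 'a ^ 'a \<Rightarrow> bool" where
  "sym_mat M \<longleftrightarrow> transpose M = M"

definition pos_def :: "real ^ 'a ^ 'a \<Rightarrow> bool" where
  "pos_def M \<longleftrightarrow> sym_mat M \<and> (\<forall>x. x \<noteq> 0 \<longrightarrow> x \<bullet> (M *v x) > 0)"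

definition param_seqs :: "(real ^ 'p) set \<Rightarrow> (nat \<Rightarrow> real ^ 'p) set" where
  "param_seqs Ps = {p. \<forall>k. p k \<in> Ps}"

definition poly_mat ::
    "('n::finite \<Rightarrow> real ^ 'p \<Rightarrow> real) \<Rightarrow> ('n \<Rightarrow> real ^ 'a ^ 'b) \<Rightarrow> real ^ 'p \<Rightarrow> real ^ 'a ^ 'b" where
  "poly_mat \<xi> M \<pi> = (\<Sum>i\<in>UNIV. \<xi> i \<pi> *\<^sub>R M i)"

definition polytopic ::
    "(real ^ 'p) set \<Rightarrow> (real ^ 'p \<Rightarrow> real ^ 'x ^ 'x)
     \<Rightarrow> ('n::finite \<Rightarrow> real ^ 'p \<Rightarrow> real) \<Rightarrow> ('n \<Rightarrow> real ^ 'x ^ 'x) \<Rightarrow> bool" where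
  "polytopic Ps A \<xi> Av \<longleftrightarrow>
     (\<forall>i. continuous_on Ps (\<xi> i)) \<and>
     (\<forall>i. \<forall>\<pi>\<in>Ps. \<xi> i \<pi> \<ge> 0) \<and>
     (\<forall>\<pi>\<in>Ps. (\<Sum>i\<in>UNIV. \<xi> i \<pi>) = 1) \<and>
     (\<forall>\<pi>\<in>Ps. A \<pi> = poly_mat \<xi> Av \<pi>)"

definition strictly_polytopic ::
    "(real ^ 'p) set \<Rightarrow> (real ^ 'p \<Rightarrow> real ^ 'x ^ 'x)
     \<Rightarrow> ('n::finite \<Rightarrow> real ^ 'p \<Rightarrow> real) \<Rightarrow> ('n \<Rightarrow> real ^ 'x ^ 'x) \<Rightarrow> bool" where
  "strictly_polytopic Ps A \<xi> Av \<longleftrightarrow>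
     polytopic Ps A \<xi> Av \<and> (\<forall>i. axis i 1 \<in> (\<lambda>\<pi>. \<chi> j. \<xi> j \<pi>) ` Ps)"

text \<open>The system \<open>x\<^sub>k\<^sub>+\<^sub>1 = F(k, p) x\<^sub>k\<close> is represented by \<open>F\<close>, and only its values at
  sequences \<open>p \<in> param_seqs Ps\<close> matter.\<close>

definition poly_QLF ::
    "(real ^ 'p) set \<Rightarrow> ('n::finite \<Rightarrow> real ^ 'p \<Rightarrow> real)
     \<Rightarrow> (nat \<Rightarrow> (nat \<Rightarrow> real ^ 'p) \<Rightarrow> real ^ 'x ^ 'x)
     \<Rightarrow> (real ^ 'p \<Rightarrow> real ^ 'x \<Rightarrow> real) \<Rightarrow> bool" where
  "poly_QLF Ps \<xi> F V \<longleftrightarrow>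
     (\<exists>Pb :: 'n \<Rightarrow> real ^ 'x ^ 'x. (\<forall>i. sym_mat (Pb i)) \<and>
        (\<forall>\<pi>\<in>Ps. \<forall>x. V \<pi> x = x \<bullet> (poly_mat \<xi> Pb \<pi> *v x))) \<and>
     (\<exists>a1 a2 a3. a1 > 0 \<and> a2 > 0 \<and> a3 > 0 \<and>
        (\<forall>\<pi>\<in>Ps. \<forall>x. a1 * (norm x)\<^sup>2 \<le> V \<pi> x \<and> V \<pi> x \<le> a2 * (norm x)\<^sup>2) \<and>
        (\<forall>k. \<forall>p\<in>param_seqs Ps. \<forall>x.
           V (p (Suc k)) (F k p *v x) \<le> V (p k) x - a3 * (norm x)\<^sup>2))"

definition poly_QS ::
    "(real ^ 'p) set \<Rightarrow> ('n::finite \<Rightarrow> real ^ 'p \<Rightarrow> real)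
     \<Rightarrow> (nat \<Rightarrow> (nat \<Rightarrow> real ^ 'p) \<Rightarrow> real ^ 'x ^ 'x) \<Rightarrow> bool" where
  "poly_QS Ps \<xi> F \<longleftrightarrow> (\<exists>V. poly_QLF Ps \<xi> F V)"

definition plant_step ::
    "(real ^ 'p \<Rightarrow> real ^ 'x ^ 'x) \<Rightarrow> real ^ 'u ^ 'x
     \<Rightarrow> nat \<Rightarrow> (nat \<Rightarrow> real ^ 'p) \<Rightarrow> real ^ 'u \<Rightarrow> real ^ 'x \<Rightarrow> real ^ 'x" where
  "plant_step A B k p u x = A (p k) *v x + B *v u"

definition observer_step ::
    "(real ^ 'p \<Rightarrow> real ^ 'x ^ 'x) \<Rightarrow> real ^ 'u ^ 'x \<Rightarrow> real ^ 'x ^ 'y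
     \<Rightarrow> (nat \<Rightarrow> (nat \<Rightarrow> real ^ 'p) \<Rightarrow> real ^ 'y ^ 'x)
     \<Rightarrow> nat \<Rightarrow> (nat \<Rightarrow> real ^ 'p) \<Rightarrow> real ^ 'u \<Rightarrow> real ^ 'y \<Rightarrow> real ^ 'x \<Rightarrow> real ^ 'x" where
  "observer_step A B C L k p u y xh =
     A (p k) *v xh + L k p *v (C *v xh - y) + B *v u"

definition error_system ::
    "(real ^ 'p \<Rightarrow> real ^ 'x ^ 'x) \<Rightarrow> real ^ 'x ^ 'y
     \<Rightarrow> (nat \<Rightarrow> (nat \<Rightarrow> real ^ 'p) \<Rightarrow> real ^ 'y ^ 'x)
     \<Rightarrow> nat \<Rightarrow> (nat \<Rightarrow> real ^ 'p) \<Rightarrow> real ^ 'x ^ 'x" where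
  "error_system A C L k p = A (p k) + L k p ** C"

text \<open>The input matrix \<open>B\<close> and the input cancel in the observation error, which is why
  neither is an argument of \<open>error_system\<close> or of \<open>poly_Q_detectable\<close> below.\<close>

lemma error_system_step:
  "observer_step A B C L k p u (C *v x) xh - plant_step A B k p u x
   = error_system A C L k p *v (xh - x)"
  by (simp add: observer_step_def plant_step_def error_system_def matrix_vector_mult_add_rdistrib
      matrix_vector_mult_diff_distrib matrix_vector_mul_assoc[symmetric])

definition poly_Q_detectable ::
    "(real ^ 'p) set \<Rightarrow> (real ^ 'p \<Rightarrow> real ^ 'x ^ 'x) \<Rightarrow> real ^ 'x ^ 'y
     \<Rightarrow> ('n::finite \<Rightarrow> real ^ 'p \<Rightarrow> real) \<Rightarrow> bool" where
  "poly_Q_detectable Ps A C \<xi> \<longleftrightarrow>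
     (\<exists>L :: nat \<Rightarrow> (nat \<Rightarrow> real ^ 'p) \<Rightarrow> real ^ 'y ^ 'x. poly_QS Ps \<xi> (error_system A C L))"

definition detectability_LMI ::
    "('n::finite \<Rightarrow> real ^ 'x ^ 'x) \<Rightarrow> real ^ 'x ^ 'y \<Rightarrow> ('n \<Rightarrow> real ^ 'x ^ 'x) \<Rightarrow> bool" where
  "detectability_LMI Av C Pb \<longleftrightarrow>
     (\<forall>i. pos_def (Pb i)) \<and>
     (\<forall>i j. pos_def (Pb i - transpose (Av i) ** Pb j ** Av i + transpose C ** C))"

definition observer_gain ::
    "('n::finite \<Rightarrow> real ^ 'p \<Rightarrow> real) \<Rightarrow> ('n \<Rightarrow> real ^ 'x ^ 'x) \<Rightarrow> real ^ 'x ^ 'y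
     \<Rightarrow> ('n \<Rightarrow> real ^ 'x ^ 'x) \<Rightarrow> nat \<Rightarrow> (nat \<Rightarrow> real ^ 'p) \<Rightarrow> real ^ 'y ^ 'x" where
  "observer_gain \<xi> Av C Pb k p =
     - (\<Sum>i\<in>UNIV. \<xi> i (p k) *\<^sub>R
          (Av i ** matrix_inv (Pb i + transpose C ** C) ** transpose C))"

end

theory Submission
  imports Defs
begin

text \<open>Necessity: evaluating the Lyapunov inequality at parameters with \<open>\<xi> = e\<^sub>i\<close> and
  \<open>\<xi> = e\<^sub>j\<close> gives \<open>(A\<^sub>i + LC)\<^sup>T P\<^sub>j (A\<^sub>i + LC) \<le> P\<^sub>i - a\<^sub>3 I\<close>. Writing
  \<open>A\<^sub>i x = (A\<^sub>i + LC) x - LCx\<close> and using Young's inequality with a small parameter bounds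
  \<open>A\<^sub>i\<^sup>T P\<^sub>j A\<^sub>i\<close> strictly by \<open>P\<^sub>i + \<mu> C\<^sup>T C\<close>, and dividing all \<open>P\<^sub>i\<close> by a common \<open>\<mu>\<close> yields
  the LMI.

  Sufficiency: with \<open>S\<^sub>i = P\<^sub>i + C\<^sup>T C\<close> the proposed gain gives the vertex matrices
  \<open>A\<^sub>i S\<^sub>i\<^sup>-\<^sup>1 P\<^sub>i\<close>. For \<open>y = S\<^sub>i\<^sup>-\<^sup>1 P\<^sub>i x\<close>, expanding \<open>(x - y)\<^sup>T P\<^sub>i (x - y) \<ge> 0\<close> gives
  \<open>x\<^sup>T P\<^sub>i x \<ge> y\<^sup>T S\<^sub>i y\<close>, which exceeds \<open>(A\<^sub>i y)\<^sup>T P\<^sub>j (A\<^sub>i y)\<close> by the LMI. Convexity of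
  quadratic forms extends the decrease from the vertices to all parameters.\<close>

section \<open>Quadratic forms\<close>

lemma sym_mat_dot:
  assumes "sym_mat M"
  shows "x \<bullet> (M *v y) = y \<bullet> (M *v x)"
  using assms by (metis sym_mat_def dot_lmul_matrix transpose_matrix_vector inner_commute)

lemma dot_congruence:
  "x \<bullet> ((transpose A ** M ** A) *v x) = (A *v x) \<bullet> (M *v (A *v x))" for x :: "real ^ 'a"
  by (metis dot_lmul_matrix matrix_vector_mul_assoc transpose_matrix_vector inner_commute)

lemma dot_gram: "x \<bullet> ((transpose C ** C) *v x) = (norm (C *v x))\<^sup>2" for x :: "real ^ 'a"
  by (metis dot_lmul_matrix matrix_vector_mul_assoc transpose_matrix_vector inner_commute
      power2_norm_eq_inner)

lemma sum_matrix_vector_mult: "(\<Sum>i\<in>I. M i) *v x = (\<Sum>i\<in>I. M i *v x)"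
  for M :: "'i \<Rightarrow> real ^ 'a ^ 'b"
  by (induction I rule: infinite_finite_induct)
    (simp_all add: matrix_vector_mult_add_rdistrib)

lemma poly_mat_mult_vec: "poly_mat \<xi> M \<pi> *v x = (\<Sum>i\<in>UNIV. \<xi> i \<pi> *\<^sub>R (M i *v x))"
  by (simp add: poly_mat_def sum_matrix_vector_mult scaleR_matrix_vector_assoc)

lemma dot_poly_mat: "x \<bullet> (poly_mat \<xi> M \<pi> *v y) = (\<Sum>i\<in>UNIV. \<xi> i \<pi> * (x \<bullet> (M i *v y)))"
  by (simp add: poly_mat_mult_vec inner_sum_right)

lemma sym_mat_congruence:
  assumes "sym_mat M"
  shows "sym_mat (transpose A ** M ** A)"
  using assms by (simp add: sym_mat_def matrix_transpose_mul matrix_mul_assoc)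

lemma transpose_add: "transpose (A + B) = transpose A + transpose B" for A :: "real ^ 'a ^ 'b"
  by (simp add: transpose_def vec_eq_iff)

lemma transpose_diff: "transpose (A - B) = transpose A - transpose B" for A :: "real ^ 'a ^ 'b"
  by (simp add: transpose_def vec_eq_iff)

lemma sym_mat_add: "sym_mat A \<Longrightarrow> sym_mat B \<Longrightarrow> sym_mat (A + B)"
  by (simp add: sym_mat_def transpose_add)

lemma sym_mat_diff: "sym_mat A \<Longrightarrow> sym_mat B \<Longrightarrow> sym_mat (A - B)"
  by (simp add: sym_mat_def transpose_diff)

lemma sym_mat_scaleR: "sym_mat A \<Longrightarrow> sym_mat (c *\<^sub>R A)"
  by (simp add: sym_mat_def transpose_scalar)

lemma sym_mat_gram: "sym_mat (transpose C ** C)"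
  by (simp add: sym_mat_def matrix_transpose_mul)

lemma pos_def_sym: "pos_def M \<Longrightarrow> sym_mat M"
  by (simp add: pos_def_def)

lemma pos_def_pos: "pos_def M \<Longrightarrow> x \<noteq> 0 \<Longrightarrow> 0 < x \<bullet> (M *v x)"
  by (simp add: pos_def_def)

lemma pos_def_nonneg: "pos_def M \<Longrightarrow> 0 \<le> x \<bullet> (M *v x)"
  by (cases "x = 0") (auto dest: pos_def_pos[of M x])

section \<open>Uniform bounds on quadratic forms over finite families\<close>

text \<open>The form attains its minimum on the compact unit sphere; that value is positive, and
  homogeneity of degree two carries it to all vectors.\<close>

lemma pos_def_lower_bound:
  fixes M :: "real ^ 'a ^ 'a"
  assumes "pos_def M"
  shows "\<exists>c>0. \<forall>x. c * (norm x)\<^sup>2 \<le> x \<bullet> (M *v x)"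
proof -
  let ?S = "sphere (0 :: real ^ 'a) 1"
  have "continuous_on ?S (\<lambda>x. x \<bullet> (M *v x))"
    by (intro continuous_intros linear_continuous_on linear_conv_bounded_linear[THEN iffD1]
        matrix_vector_mul_linear)
  \<comment> \<open>A witness that the sphere is nonempty, as attaining an infimum requires.\<close>
  moreover have "axis undefined 1 \<in> ?S" by simp
  ultimately obtain z where z: "z \<in> ?S" "\<And>x. x \<in> ?S \<Longrightarrow> z \<bullet> (M *v z) \<le> x \<bullet> (M *v x)"
    using continuous_attains_inf[of ?S "\<lambda>x. x \<bullet> (M *v x)"] compact_sphere by blast
  have "(z \<bullet> (M *v z)) * (norm x)\<^sup>2 \<le> x \<bullet> (M *v x)" for x
  proof (cases "x = 0")
    case False
    have "z \<bullet> (M *v z) \<le> (x /\<^sub>R norm x) \<bullet> (M *v (x /\<^sub>R norm x))"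
      using False by (intro z) simp
    also have "\<dots> = (x \<bullet> (M *v x)) / (norm x)\<^sup>2"
      by (simp add: matrix_vector_mult_scaleR divide_simps power2_eq_square)
    finally show ?thesis
      using False by (simp add: pos_le_divide_eq)
  qed simp
  moreover have "z \<noteq> 0" using z(1) by auto
  ultimately show ?thesis
    using pos_def_pos[OF assms] by blast
qed

text \<open>The smallest of finitely many positive constants is still positive. Taken over vertices
  this yields \<open>a1\<close>, taken over pairs of vertices it yields \<open>a3\<close>.\<close>

lemma pos_def_family_lower_bound:
  fixes M :: "'i::finite \<Rightarrow> real ^ 'a ^ 'a"
  assumes "\<And>i. pos_def (M i)"
  shows "\<exists>c>0. \<forall>i x. c * (norm x)\<^sup>2 \<le> x \<bullet> (M i *v x)"
proof -
  obtain c where c: "\<And>i. c i > 0" "\<And>i x. c i * (norm x)\<^sup>2 \<le> x \<bullet> (M i *v x)"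
    using pos_def_lower_bound[OF assms] by metis
  have "Min (range c) * (norm x)\<^sup>2 \<le> x \<bullet> (M i *v x)" for i x
    using c(2)[of i x] mult_right_mono[of "Min (range c)" "c i" "(norm x)\<^sup>2"] by fastforce
  moreover have "Min (range c) > 0"
    using c(1) by simp
  ultimately show ?thesis by blast
qed

lemma quadratic_form_upper_bound:
  "x \<bullet> (M *v x) \<le> onorm ((*v) M) * (norm x)\<^sup>2" for M :: "real ^ 'a ^ 'a"
proof -
  have "x \<bullet> (M *v x) \<le> norm x * norm (M *v x)"
    by (rule norm_cauchy_schwarz)
  also have "\<dots> \<le> norm x * (onorm ((*v) M) * norm x)"
    by (intro mult_left_mono onorm) simp_all
  finally show ?thesis by (simp add: power2_eq_square mult_ac)
qed

lemma quadratic_form_family_upper_bound: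
  fixes M :: "'i::finite \<Rightarrow> real ^ 'a ^ 'a"
  shows "\<exists>c>0. \<forall>i x. x \<bullet> (M i *v x) \<le> c * (norm x)\<^sup>2"
proof -
  \<comment> \<open>The summand 1 keeps the constant positive even if all the matrices
    vanish.\<close>
  let ?c = "(\<Sum>i\<in>UNIV. onorm ((*v) (M i))) + 1"
  have nonneg: "onorm ((*v) (M i)) \<ge> 0" for i
    by (intro onorm_pos_le) simp
  have "x \<bullet> (M i *v x) \<le> ?c * (norm x)\<^sup>2" for i x
  proof -
    have "onorm ((*v) (M i)) \<le> ?c"
      using member_le_sum[of i UNIV "\<lambda>i. onorm ((*v) (M i))"] nonneg by simp
    then show ?thesis
      using quadratic_form_upper_bound[of x "M i"]
        mult_right_mono[of "onorm ((*v) (M i))" ?c "(norm x)\<^sup>2"] by simp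
  qed
  moreover have "?c > 0" using nonneg by (simp add: add_nonneg_pos sum_nonneg)
  ultimately show ?thesis by blast
qed

section \<open>Convexity and Young's inequality\<close>

lemma quadratic_form_diff:
  assumes "sym_mat M"
  shows "(x - y) \<bullet> (M *v (x - y)) = x \<bullet> (M *v x) - 2 * (y \<bullet> (M *v x)) + y \<bullet> (M *v y)"
  using sym_mat_dot[OF assms, of x y]
  by (simp add: matrix_vector_mult_diff_distrib inner_diff_left inner_diff_right)

text \<open>A convex function lies above its tangent at the mean \<open>w\<close>. The tangent is
  affine, so its weighted average over the points is its value at \<open>w\<close>, namely the form
  itself.\<close>

lemma quadratic_form_jensen:
  fixes v :: "'i::finite \<Rightarrow> real ^ 'a"
  assumes M: "pos_def M" and t: "\<And>i. t i \<ge> 0" "(\<Sum>i\<in>UNIV. t i) = 1"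
  shows "(\<Sum>i\<in>UNIV. t i *\<^sub>R v i) \<bullet> (M *v (\<Sum>i\<in>UNIV. t i *\<^sub>R v i))
         \<le> (\<Sum>i\<in>UNIV. t i * (v i \<bullet> (M *v v i)))"
proof -
  define w where "w = (\<Sum>i\<in>UNIV. t i *\<^sub>R v i)"
  have "2 * (v i \<bullet> (M *v w)) - w \<bullet> (M *v w) \<le> v i \<bullet> (M *v v i)" for i
    using pos_def_nonneg[OF M, of "w - v i"] quadratic_form_diff[OF pos_def_sym[OF M], of w "v i"]
    by simp
  then have "(\<Sum>i\<in>UNIV. t i * (2 * (v i \<bullet> (M *v w)) - w \<bullet> (M *v w)))
             \<le> (\<Sum>i\<in>UNIV. t i * (v i \<bullet> (M *v v i)))"
    by (intro sum_mono mult_left_mono t)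
  moreover have "(\<Sum>i\<in>UNIV. t i * (v i \<bullet> (M *v w))) = w \<bullet> (M *v w)"
    by (subst (2) w_def) (simp add: inner_sum_left)
  then have "(\<Sum>i\<in>UNIV. t i * (2 * (v i \<bullet> (M *v w)) - w \<bullet> (M *v w))) = w \<bullet> (M *v w)"
    using t(2) by (simp add: right_diff_distrib sum_subtractf mult.left_commute[of _ 2]
        flip: sum_distrib_left sum_distrib_right)
  ultimately show ?thesis by (simp add: w_def)
qed

lemma quadratic_form_young:
  assumes M: "pos_def M" and "e > 0"
  shows "(x - y) \<bullet> (M *v (x - y)) \<le> (1 + e) * (x \<bullet> (M *v x)) + (1 + 1 / e) * (y \<bullet> (M *v y))"
proof -
  \<comment> \<open>With this choice \<open>x - c *\<^sub>R y\<close> is x + y/e, and e times its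
    form is exactly the gap between the two sides of the claim: \<open>e * c = -1\<close> turns the
    cross term into +2 and leaves 1/e in front of the form of y.\<close>
  define c where "c = - 1 / e"
  have "0 \<le> e * ((x - c *\<^sub>R y) \<bullet> (M *v (x - c *\<^sub>R y)))"
    using pos_def_nonneg[OF M] \<open>e > 0\<close> by simp
  also have "\<dots> = e * (x \<bullet> (M *v x)) - 2 * (e * c) * (y \<bullet> (M *v x)) + (e * c) * c * (y \<bullet> (M *v y))"
    unfolding quadratic_form_diff[OF pos_def_sym[OF M]]
    by (simp add: matrix_vector_mult_scaleR algebra_simps)
  also have "\<dots> = e * (x \<bullet> (M *v x)) + 2 * (y \<bullet> (M *v x)) + (y \<bullet> (M *v y)) / e"
    using \<open>e > 0\<close> by (simp add: c_def)
  finally have "0 \<le> e * (x \<bullet> (M *v x)) + 2 * (y \<bullet> (M *v x)) + (y \<bullet> (M *v y)) / e" .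
  then show ?thesis
    unfolding quadratic_form_diff[OF pos_def_sym[OF M]] by (simp add: algebra_simps)
qed

section \<open>Invertibility of positive definite matrices\<close>

lemma pos_def_add_gram:
  assumes "pos_def M"
  shows "pos_def (M + transpose C ** C)"
  using assms unfolding pos_def_def
  by (auto simp: sym_mat_add sym_mat_gram matrix_vector_mult_add_rdistrib inner_add_right dot_gram
      intro: add_pos_nonneg)

lemma pos_def_matrix_inv:
  fixes M :: "real ^ 'a ^ 'a"
  assumes "pos_def M"
  shows "M ** matrix_inv M = mat 1" "matrix_inv M ** M = mat 1"
proof -
  have "\<And>x. M *v x = 0 \<Longrightarrow> x = 0"
    using pos_def_pos[OF assms] by (metis inner_zero_right less_irrefl)
  then have "invertible M"
    by (simp add: invertible_left_inverse matrix_left_invertible_ker)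
  \<comment> \<open>\<open>matrix_inv\<close> is a choice of two-sided inverse, so existence of one
    transfers both equations to it.\<close>
  then have "M ** matrix_inv M = mat 1 \<and> matrix_inv M ** M = mat 1"
    unfolding matrix_inv_def invertible_def by (rule someI_ex)
  then show "M ** matrix_inv M = mat 1" "matrix_inv M ** M = mat 1"
    by blast+
qed

section \<open>Sufficiency of the LMI\<close>

text \<open>The matrix A + LC for the vertex gain L = -A S^-1 C^T with S = P + C^T C. The factored
  form exposes the vector S^-1 P x on which the LMI is evaluated.\<close>

definition closed_loop_vertex ::
    "real ^ 'x ^ 'x \<Rightarrow> real ^ 'x ^ 'y \<Rightarrow> real ^ 'x ^ 'x \<Rightarrow> real ^ 'x ^ 'x" where
  "closed_loop_vertex A C P = A ** matrix_inv (P + transpose C ** C) ** P"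

text \<open>Insert S^-1 S = I after A and split S into its two summands.\<close>

lemma closed_loop_vertex_eq:
  assumes "pos_def P"
  shows "closed_loop_vertex A C P
         = A - A ** matrix_inv (P + transpose C ** C) ** transpose C ** C"
proof -
  let ?S = "P + transpose C ** C"
  have "A = A ** matrix_inv ?S ** ?S"
    by (simp add: pos_def_matrix_inv[OF pos_def_add_gram[OF assms]] flip: matrix_mul_assoc)
  also have "\<dots> = closed_loop_vertex A C P + A ** matrix_inv ?S ** transpose C ** C"
    by (simp add: closed_loop_vertex_def matrix_add_ldistrib matrix_mul_assoc)
  finally show ?thesis by (simp add: eq_diff_eq)
qed

lemma closed_loop_vertex_decrease:
  assumes P: "pos_def P" and Q: "pos_def Q"
    and lmi: "pos_def (P - transpose A ** Q ** A + transpose C ** C)"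
  shows "pos_def (P - transpose (closed_loop_vertex A C P) ** Q ** closed_loop_vertex A C P)"
proof -
  let ?S = "P + transpose C ** C" and ?M = "closed_loop_vertex A C P"
  have "0 < x \<bullet> ((P - transpose ?M ** Q ** ?M) *v x)" if "x \<noteq> 0" for x
  proof -
    define y where "y = matrix_inv ?S *v (P *v x)"
    have Mx: "?M *v x = A *v y"
      by (simp add: closed_loop_vertex_def y_def matrix_vector_mul_assoc matrix_mul_assoc)
    have Sy: "?S *v y = P *v x"
      by (simp only: y_def matrix_vector_mul_assoc matrix_mul_assoc matrix_mul_lid
          pos_def_matrix_inv[OF pos_def_add_gram[OF P]])
    \<comment> \<open>If y were zero, P x = S y would vanish, against positivity of the form of P at
      x.\<close>
    have "y \<noteq> 0"
      using Sy pos_def_pos[OF P that] by auto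
    have "y \<bullet> (P *v x) = y \<bullet> (P *v y) + (norm (C *v y))\<^sup>2"
      by (simp flip: Sy add: matrix_vector_mult_add_rdistrib inner_add_right dot_gram)
    \<comment> \<open>The square of x - y gives the lower bound 2 y.Px - y.Py, hence two copies of
      the output term. One is spent on the LMI at y, the other is dropped as nonnegative.\<close>
    then have "x \<bullet> (P *v x) \<ge> y \<bullet> (P *v y) + 2 * (norm (C *v y))\<^sup>2"
      using pos_def_nonneg[OF P, of "x - y"] quadratic_form_diff[OF pos_def_sym[OF P], of x y]
      by simp
    moreover have "0 < y \<bullet> (P *v y) - (A *v y) \<bullet> (Q *v (A *v y)) + (norm (C *v y))\<^sup>2"
      using pos_def_pos[OF lmi \<open>y \<noteq> 0\<close>]
      by (simp add: matrix_vector_mult_add_rdistrib matrix_vector_mult_diff_rdistrib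
          inner_add_right inner_diff_right dot_gram dot_congruence)
    ultimately have "(A *v y) \<bullet> (Q *v (A *v y)) < x \<bullet> (P *v x)"
      using zero_le_power2[of "norm (C *v y)"] by linarith
    then show ?thesis
      by (simp add: matrix_vector_mult_diff_rdistrib inner_diff_right dot_congruence Mx)
  qed
  then show ?thesis
    unfolding pos_def_def
    using pos_def_sym[OF P] pos_def_sym[OF Q] by (simp add: sym_mat_diff sym_mat_congruence)
qed

lemma matrix_add_rdistrib: "(A + B) ** C = A ** C + B ** C" for A :: "real ^ 'a ^ 'b"
  by (simp add: matrix_matrix_mult_def vec_eq_iff algebra_simps sum.distrib)

lemma sum_matrix_mult: "(\<Sum>i\<in>I. M i) ** C = (\<Sum>i\<in>I. M i ** C)"
  for M :: "'i \<Rightarrow> real ^ 'a ^ 'b"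
  by (induction I rule: infinite_finite_induct) (simp_all add: matrix_add_rdistrib)

text \<open>\<open>C\<close> is constant and the gain carries the same weights as \<open>A\<close>,
  so the two combine vertex by vertex and the closed loop is again polytopic.\<close>

lemma error_system_observer_gain:
  assumes "polytopic Ps A \<xi> Av" "p \<in> param_seqs Ps" "\<And>i. pos_def (Pb i)"
  shows "error_system A C (observer_gain \<xi> Av C Pb) k p
         = poly_mat \<xi> (\<lambda>i. closed_loop_vertex (Av i) C (Pb i)) (p k)"
proof -
  have "A (p k) = poly_mat \<xi> Av (p k)"
    using assms(1,2) by (simp add: polytopic_def param_seqs_def)
  \<comment> \<open>The minus sign moves into the weights, so that multiplication by
    \<open>C\<close> passes through a plain sum of scaled matrices.\<close>
  moreover have "observer_gain \<xi> Av C Pb k p = (\<Sum>i\<in>UNIV. (- \<xi> i (p k)) *\<^sub>R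
          (Av i ** matrix_inv (Pb i + transpose C ** C) ** transpose C))"
    by (simp add: observer_gain_def sum_negf)
  then have "observer_gain \<xi> Av C Pb k p ** C = (\<Sum>i\<in>UNIV. (- \<xi> i (p k)) *\<^sub>R
          (Av i ** matrix_inv (Pb i + transpose C ** C) ** transpose C ** C))"
    by (simp only: sum_matrix_mult flip: scalar_matrix_assoc)
  ultimately show ?thesis
    by (simp add: error_system_def poly_mat_def closed_loop_vertex_eq assms(3)
        scaleR_diff_right sum_subtractf sum_negf)
qed

lemma observer_gain_poly_QLF:
  fixes \<xi> :: "'n::finite \<Rightarrow> real ^ 'p \<Rightarrow> real" and Pb :: "'n \<Rightarrow> real ^ 'x ^ 'x"
  assumes poly: "polytopic Ps A \<xi> Av" and lmi: "detectability_LMI Av C Pb"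
  shows "poly_QLF Ps \<xi> (error_system A C (observer_gain \<xi> Av C Pb))
           (\<lambda>\<pi> e. e \<bullet> (poly_mat \<xi> Pb \<pi> *v e))"
proof -
  have Pb: "pos_def (Pb i)" for i
    using lmi by (simp add: detectability_LMI_def)
  define M where "M i = closed_loop_vertex (Av i) C (Pb i)" for i
  have \<xi>: "\<xi> i \<pi> \<ge> 0" "(\<Sum>i\<in>UNIV. \<xi> i \<pi>) = 1" if "\<pi> \<in> Ps" for i \<pi>
    using poly that by (auto simp: polytopic_def)
  have average: "(\<Sum>i\<in>UNIV. \<xi> i \<pi> * c) = c" if "\<pi> \<in> Ps" for \<pi> c
    using \<xi>(2)[OF that] by (simp flip: sum_distrib_right)
  obtain a1 where a1: "a1 > 0" "\<And>i x. a1 * (norm x)\<^sup>2 \<le> x \<bullet> (Pb i *v x)"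
    using pos_def_family_lower_bound[of Pb] Pb by blast
  obtain a2 where a2: "a2 > 0" "\<And>i x. x \<bullet> (Pb i *v x) \<le> a2 * (norm x)\<^sup>2"
    using quadratic_form_family_upper_bound[of Pb] by blast
  \<comment> \<open>Pairs of vertices become one finite index, so that a single \<open>a3\<close>
    serves all of them.\<close>
  have "pos_def (Pb (fst ij) - transpose (M (fst ij)) ** Pb (snd ij) ** M (fst ij))" for ij
    unfolding M_def using lmi by (intro closed_loop_vertex_decrease) (auto simp: detectability_LMI_def)
  then obtain a3 where a3: "a3 > 0"
    "\<And>i j x. a3 * (norm x)\<^sup>2 \<le> x \<bullet> ((Pb i - transpose (M i) ** Pb j ** M i) *v x)"
    using pos_def_family_lower_bound[of
        "\<lambda>ij. Pb (fst ij) - transpose (M (fst ij)) ** Pb (snd ij) ** M (fst ij)"]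
    by (metis fst_conv snd_conv)
  have vertex: "(M i *v x) \<bullet> (Pb j *v (M i *v x)) \<le> x \<bullet> (Pb i *v x) - a3 * (norm x)\<^sup>2" for i j x
    using a3(2)[of x i j]
    by (simp add: matrix_vector_mult_diff_rdistrib inner_diff_right dot_congruence)
  have bounds: "a1 * (norm x)\<^sup>2 \<le> x \<bullet> (poly_mat \<xi> Pb \<pi> *v x)"
      "x \<bullet> (poly_mat \<xi> Pb \<pi> *v x) \<le> a2 * (norm x)\<^sup>2" if "\<pi> \<in> Ps" for \<pi> x
  proof -
    have "(\<Sum>i\<in>UNIV. \<xi> i \<pi> * (a1 * (norm x)\<^sup>2)) \<le> x \<bullet> (poly_mat \<xi> Pb \<pi> *v x)"
      unfolding dot_poly_mat by (intro sum_mono mult_left_mono a1 \<xi> that)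
    then show "a1 * (norm x)\<^sup>2 \<le> x \<bullet> (poly_mat \<xi> Pb \<pi> *v x)"
      by (simp only: average[OF that])
    have "x \<bullet> (poly_mat \<xi> Pb \<pi> *v x) \<le> (\<Sum>i\<in>UNIV. \<xi> i \<pi> * (a2 * (norm x)\<^sup>2))"
      unfolding dot_poly_mat by (intro sum_mono mult_left_mono a2 \<xi> that)
    then show "x \<bullet> (poly_mat \<xi> Pb \<pi> *v x) \<le> a2 * (norm x)\<^sup>2"
      by (simp only: average[OF that])
  qed
  \<comment> \<open>Consecutive parameters of a sequence are unrelated, hence two independent ones
    here. The left side is quadratic in the weights at \<open>\<pi>\<close>, which calls for Jensen,
    but linear in those at \<open>\<pi>'\<close>, so a vertex j is fixed first and averaged
    afterwards.\<close>
  have decrease: "(poly_mat \<xi> M \<pi> *v x) \<bullet> (poly_mat \<xi> Pb \<pi>' *v (poly_mat \<xi> M \<pi> *v x))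
      \<le> x \<bullet> (poly_mat \<xi> Pb \<pi> *v x) - a3 * (norm x)\<^sup>2" if "\<pi> \<in> Ps" "\<pi>' \<in> Ps" for \<pi> \<pi>' x
  proof -
    let ?z = "poly_mat \<xi> M \<pi> *v x"
    have "?z \<bullet> (Pb j *v ?z) \<le> x \<bullet> (poly_mat \<xi> Pb \<pi> *v x) - a3 * (norm x)\<^sup>2" for j
    proof -
      have "?z \<bullet> (Pb j *v ?z) \<le> (\<Sum>i\<in>UNIV. \<xi> i \<pi> * ((M i *v x) \<bullet> (Pb j *v (M i *v x))))"
        unfolding poly_mat_mult_vec by (intro quadratic_form_jensen Pb \<xi> that)
      also have "\<dots> \<le> (\<Sum>i\<in>UNIV. \<xi> i \<pi> * (x \<bullet> (Pb i *v x) - a3 * (norm x)\<^sup>2))"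
        by (intro sum_mono mult_left_mono vertex \<xi> that)
      finally show ?thesis
        by (simp only: dot_poly_mat right_diff_distrib sum_subtractf average[OF that(1)])
    qed
    then have "?z \<bullet> (poly_mat \<xi> Pb \<pi>' *v ?z)
        \<le> (\<Sum>j\<in>UNIV. \<xi> j \<pi>' * (x \<bullet> (poly_mat \<xi> Pb \<pi> *v x) - a3 * (norm x)\<^sup>2))"
      unfolding dot_poly_mat[of ?z] by (intro sum_mono mult_left_mono \<xi> that)
    then show ?thesis
      by (simp only: average[OF that(2)])
  qed
  have "error_system A C (observer_gain \<xi> Av C Pb) k p = poly_mat \<xi> M (p k)"
    if "p \<in> param_seqs Ps" for k p
    unfolding M_def using error_system_observer_gain[OF poly that Pb] .
  then show ?thesis
    unfolding poly_QLF_def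
    using a1(1) a2(1) a3(1) bounds decrease pos_def_sym[OF Pb]
    by (intro conjI exI[of _ Pb] exI[of _ a1] exI[of _ a2] exI[of _ a3])
      (auto simp: param_seqs_def)
qed

section \<open>Necessity of the LMI\<close>

text \<open>Strictness supplies such parameters, and there \<open>A\<close> and the Lyapunov matrix
  reduce to vertex matrices simultaneously.\<close>

lemma poly_mat_axis:
  assumes "(\<chi> j. \<xi> j \<pi>) = axis i 1"
  shows "poly_mat \<xi> M \<pi> = M i"
proof -
  have "\<xi> j \<pi> = (if j = i then 1 else 0)" for j
    using assms by (simp add: vec_eq_iff axis_def)
  then show ?thesis
    by (simp add: poly_mat_def if_distrib[of "\<lambda>t. t *\<^sub>R _"] cong: if_cong)
qed

text \<open>Eliminates the unknown gain: \<open>L\<close> survives only in the size of the constant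
  \<open>\<mu>\<close>.\<close>

lemma output_injection_bound:
  fixes A :: "real ^ 'x ^ 'x" and C :: "real ^ 'x ^ 'y" and L :: "real ^ 'y ^ 'x"
  assumes Q: "pos_def Q" and a3: "a3 > 0"
    and P: "\<And>x. x \<noteq> 0 \<Longrightarrow> 0 < x \<bullet> (P *v x)"
    and decrease: "\<And>x. ((A + L ** C) *v x) \<bullet> (Q *v ((A + L ** C) *v x))
                     \<le> x \<bullet> (P *v x) - a3 * (norm x)\<^sup>2"
  shows "\<exists>\<mu>>0. \<forall>x. x \<noteq> 0 \<longrightarrow>
           (A *v x) \<bullet> (Q *v (A *v x)) < x \<bullet> (P *v x) + \<mu> * (norm (C *v x))\<^sup>2"
proof -
  obtain a2 where a2: "a2 > 0" "\<And>x. x \<bullet> (P *v x) \<le> a2 * (norm x)\<^sup>2"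
    using quadratic_form_family_upper_bound[of "\<lambda>_ :: unit. P"] by blast
  obtain b where b: "b > 0" "\<And>z. z \<bullet> ((transpose L ** Q ** L) *v z) \<le> b * (norm z)\<^sup>2"
    using quadratic_form_family_upper_bound[of "\<lambda>_ :: unit. transpose L ** Q ** L"] by blast
  \<comment> \<open>Chosen so that the Young loss e x.Px is at most half of the guaranteed decrease
    \<open>a3 * (norm x)\<^sup>2\<close>, which leaves a strict inequality.\<close>
  define e where "e = a3 / (2 * a2)"
  have e: "e > 0" "e * a2 = a3 / 2"
    using a2(1) a3 by (simp_all add: e_def)
  define \<mu> where "\<mu> = (1 + 1 / e) * b"
  have "(A *v x) \<bullet> (Q *v (A *v x)) < x \<bullet> (P *v x) + \<mu> * (norm (C *v x))\<^sup>2" if "x \<noteq> 0" for x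
  proof -
    let ?z = "(A + L ** C) *v x" and ?w = "L *v (C *v x)"
    have "A *v x = ?z - ?w"
      by (simp add: matrix_vector_mult_add_rdistrib matrix_vector_mul_assoc)
    then have "(A *v x) \<bullet> (Q *v (A *v x))
        \<le> (1 + e) * (?z \<bullet> (Q *v ?z)) + (1 + 1 / e) * (?w \<bullet> (Q *v ?w))"
      using quadratic_form_young[OF Q e(1), of ?z ?w] by simp
    also have "\<dots> \<le> (1 + e) * (x \<bullet> (P *v x) - a3 * (norm x)\<^sup>2)
        + (1 + 1 / e) * (b * (norm (C *v x))\<^sup>2)"
      using e(1) b(2)[of "C *v x"] decrease[of x]
      by (intro add_mono mult_left_mono) (simp_all add: dot_congruence)
    also have "\<dots> < x \<bullet> (P *v x) + \<mu> * (norm (C *v x))\<^sup>2"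
    proof -
      have "e * (x \<bullet> (P *v x)) \<le> e * (a2 * (norm x)\<^sup>2)"
        using e(1) a2(2)[of x] by (intro mult_left_mono) simp_all
      also have "\<dots> = a3 / 2 * (norm x)\<^sup>2"
        using e(2) by (simp flip: mult.assoc)
      finally have "e * (x \<bullet> (P *v x)) \<le> a3 / 2 * (norm x)\<^sup>2" .
      moreover have "a3 * (norm x)\<^sup>2 > 0" "e * (a3 * (norm x)\<^sup>2) > 0"
        using that a3 e(1) by simp_all
      ultimately show ?thesis
        by (simp add: \<mu>_def algebra_simps)
    qed
    finally show ?thesis .
  qed
  moreover have "\<mu> > 0" using e(1) b(1) by (simp add: \<mu>_def add_pos_pos)
  ultimately show ?thesis by blast
qed

lemma poly_Q_detectable_imp_LMI:
  fixes Ps :: "(real ^ 'p) set" and \<xi> :: "'n::finite \<Rightarrow> real ^ 'p \<Rightarrow> real"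
    and Av :: "'n \<Rightarrow> real ^ 'x ^ 'x" and C :: "real ^ 'x ^ 'y"
  assumes strict: "strictly_polytopic Ps A \<xi> Av" and det: "poly_Q_detectable Ps A C \<xi>"
  shows "\<exists>Pb. detectability_LMI Av C Pb"
proof -
  have "\<forall>i. \<exists>\<pi>\<in>Ps. (\<chi> j. \<xi> j \<pi>) = axis i 1"
    using strict unfolding strictly_polytopic_def image_iff by metis
  then obtain q where q: "\<And>i. q i \<in> Ps" "\<And>i. (\<chi> j. \<xi> j (q i)) = axis i 1"
    by metis
  have poly_mat_q: "poly_mat \<xi> M (q i) = M i" for M :: "'n \<Rightarrow> real ^ 'x ^ 'x" and i
    using poly_mat_axis[of \<xi> "q i" i M] q(2) by simp
  have Aq: "A (q i) = Av i" for i
    using strict q(1) poly_mat_q by (simp add: strictly_polytopic_def polytopic_def)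
  obtain L V where "poly_QLF Ps \<xi> (error_system A C L) V"
    using det by (auto simp: poly_Q_detectable_def poly_QS_def)
  then obtain Pb :: "'n \<Rightarrow> real ^ 'x ^ 'x" and a1 a2 a3 where sym: "\<And>i. sym_mat (Pb i)"
    and V: "\<And>\<pi> x. \<pi> \<in> Ps \<Longrightarrow> V \<pi> x = x \<bullet> (poly_mat \<xi> Pb \<pi> *v x)"
    and a: "a1 > 0" "a3 > 0" "\<And>\<pi> x. \<pi> \<in> Ps \<Longrightarrow> a1 * (norm x)\<^sup>2 \<le> V \<pi> x"
    and dec: "\<And>k p x. p \<in> param_seqs Ps \<Longrightarrow>
      V (p (Suc k)) (error_system A C L k p *v x) \<le> V (p k) x - a3 * (norm x)\<^sup>2"
    unfolding poly_QLF_def by blast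
  have Vq: "V (q i) x = x \<bullet> (Pb i *v x)" for i x
    using V[OF q(1)] poly_mat_q by simp
  have pos: "0 < x \<bullet> (Pb i *v x)" if "x \<noteq> 0" for i x
  proof -
    have "0 < a1 * (norm x)\<^sup>2" using a(1) that by simp
    also have "\<dots> \<le> x \<bullet> (Pb i *v x)" using a(3)[OF q(1)] Vq by metis
    finally show ?thesis .
  qed
  have Pb: "pos_def (Pb i)" for i
    using sym pos by (simp add: pos_def_def)
  have "\<exists>\<mu>>0. \<forall>x. x \<noteq> 0 \<longrightarrow> (Av i *v x) \<bullet> (Pb j *v (Av i *v x))
          < x \<bullet> (Pb i *v x) + \<mu> * (norm (C *v x))\<^sup>2" for i j
  proof -
    \<comment> \<open>At time 0 this sequence realizes the transition from vertex i to vertex j. The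
      gain \<open>L 0 p\<close> may depend on the whole sequence, so the constant obtained varies
      with both i and j.\<close>
    define p where "p k = (if k = 0 then q i else q j)" for k :: nat
    have "p \<in> param_seqs Ps"
      using q(1) by (simp add: param_seqs_def p_def)
    from dec[OF this, of 0]
    have "((Av i + L 0 p ** C) *v x) \<bullet> (Pb j *v ((Av i + L 0 p ** C) *v x))
        \<le> x \<bullet> (Pb i *v x) - a3 * (norm x)\<^sup>2" for x
      by (simp add: p_def error_system_def Vq Aq)
    then show ?thesis
      using output_injection_bound[of "Pb j" a3 "Pb i" "Av i" "L 0 p" C] Pb a(2) pos by blast
  qed
  then obtain \<mu> where \<mu>: "\<And>i j. \<mu> i j > 0" "\<And>i j x. x \<noteq> 0 \<Longrightarrow>
      (Av i *v x) \<bullet> (Pb j *v (Av i *v x)) < x \<bullet> (Pb i *v x) + \<mu> i j * (norm (C *v x))\<^sup>2"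
    by metis
  \<comment> \<open>The matrices must all be rescaled by one factor, since the LMI couples
    \<open>Pb i\<close> with \<open>Pb j\<close>. The sum of the positive constants dominates each
    of them.\<close>
  define m where "m = (\<Sum>i\<in>UNIV. \<Sum>j\<in>UNIV. \<mu> i j)"
  have le_m: "\<mu> i j \<le> m" for i j
  proof -
    have "\<mu> i j \<le> (\<Sum>j\<in>UNIV. \<mu> i j)"
      using \<mu>(1) by (intro member_le_sum) (simp_all add: less_imp_le)
    also have "\<dots> \<le> m"
      unfolding m_def using \<mu>(1)
      by (intro member_le_sum[of i UNIV "\<lambda>i. \<Sum>j\<in>UNIV. \<mu> i j"])
        (simp_all add: less_imp_le sum_nonneg)
    finally show ?thesis .
  qed
  have m: "m > 0"
    using \<mu>(1) le_m less_le_trans by blast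
  \<comment> \<open>Division by m turns the output term m |Cx|^2 into |Cx|^2, the coefficient that
    the LMI prescribes.\<close>
  define Pm where "Pm i = (1 / m) *\<^sub>R Pb i" for i
  have Pm_dot: "x \<bullet> (Pm i *v y) = (x \<bullet> (Pb i *v y)) / m" for i x y
    by (simp add: Pm_def flip: scaleR_matrix_vector_assoc)
  have Pm: "pos_def (Pm i)" for i
    unfolding pos_def_def Pm_dot using pos m sym by (simp add: Pm_def sym_mat_scaleR)
  have "pos_def (Pm i - transpose (Av i) ** Pm j ** Av i + transpose C ** C)" for i j
  proof -
    have "0 < x \<bullet> ((Pm i - transpose (Av i) ** Pm j ** Av i + transpose C ** C) *v x)"
      if "x \<noteq> 0" for x
    proof -
      have "(Av i *v x) \<bullet> (Pb j *v (Av i *v x)) < x \<bullet> (Pb i *v x) + m * (norm (C *v x))\<^sup>2"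
        using \<mu>(2)[OF that, of i j] mult_right_mono[OF le_m[of i j], of "(norm (C *v x))\<^sup>2"]
        by simp
      then have "0 < (x \<bullet> (Pb i *v x) - (Av i *v x) \<bullet> (Pb j *v (Av i *v x))
          + m * (norm (C *v x))\<^sup>2) / m"
        using m by simp
      then show ?thesis
        using m by (simp add: matrix_vector_mult_add_rdistrib matrix_vector_mult_diff_rdistrib
            inner_add_right inner_diff_right dot_gram dot_congruence Pm_dot add_divide_distrib
            diff_divide_distrib)
    qed
    then show ?thesis
      unfolding pos_def_def
      by (simp add: sym_mat_add sym_mat_diff sym_mat_congruence sym_mat_gram pos_def_sym[OF Pm])
  qed
  with Pm show ?thesis
    unfolding detectability_LMI_def by blast
qed

theorem theorem1:
  fixes Ps :: "(real ^ 'p) set"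
    and A :: "real ^ 'p \<Rightarrow> real ^ 'x ^ 'x"
    and C :: "real ^ 'x ^ 'y"
    and \<xi> :: "'n::finite \<Rightarrow> real ^ 'p \<Rightarrow> real"
    and Av :: "'n \<Rightarrow> real ^ 'x ^ 'x"
  assumes "compact Ps"
  shows "(strictly_polytopic Ps A \<xi> Av \<longrightarrow>
            (poly_Q_detectable Ps A C \<xi> \<longleftrightarrow> (\<exists>Pb. detectability_LMI Av C Pb))) \<and>
         (polytopic Ps A \<xi> Av \<longrightarrow>
            (\<exists>Pb. detectability_LMI Av C Pb) \<longrightarrow> poly_Q_detectable Ps A C \<xi>) \<and>
         (polytopic Ps A \<xi> Av \<longrightarrow>
            (\<forall>Pb. detectability_LMI Av C Pb \<longrightarrow>
               poly_QS Ps \<xi> (error_system A C (observer_gain \<xi> Av C Pb)) \<and>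
               poly_QLF Ps \<xi> (error_system A C (observer_gain \<xi> Av C Pb))
                 (\<lambda>\<pi> e. e \<bullet> (poly_mat \<xi> Pb \<pi> *v e))))"
proof -
  have qlf: "poly_QLF Ps \<xi> (error_system A C (observer_gain \<xi> Av C Pb))
      (\<lambda>\<pi> e. e \<bullet> (poly_mat \<xi> Pb \<pi> *v e))"
    and qs: "poly_QS Ps \<xi> (error_system A C (observer_gain \<xi> Av C Pb))"
    and det: "poly_Q_detectable Ps A C \<xi>"
    if "polytopic Ps A \<xi> Av" "detectability_LMI Av C Pb" for Pb
  proof -
    show qlf: "poly_QLF Ps \<xi> (error_system A C (observer_gain \<xi> Av C Pb))
        (\<lambda>\<pi> e. e \<bullet> (poly_mat \<xi> Pb \<pi> *v e))"
      by (rule observer_gain_poly_QLF[OF that])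
    show qs: "poly_QS Ps \<xi> (error_system A C (observer_gain \<xi> Av C Pb))"
      unfolding poly_QS_def by (rule exI, rule qlf)
    show "poly_Q_detectable Ps A C \<xi>"
      unfolding poly_Q_detectable_def by (rule exI, rule qs)
  qed
  \<comment> \<open>This lets the construction above also give the "if" direction of the
    equivalence.\<close>
  moreover have "polytopic Ps A \<xi> Av" if "strictly_polytopic Ps A \<xi> Av"
    using that by (simp add: strictly_polytopic_def)
  ultimately show ?thesis
    by (intro conjI impI iffI allI; (elim exE)?)
      (simp_all only: poly_Q_detectable_imp_LMI)
qed

end
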